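(* Let $C$, $X$, $Z$, the set $\mathcal D$, the MAP adversary's accuracy $\Pr(\hat C=C)$, the maximal information leakage $I_\infty(C;Z)$ and the Sibson mutual information $I_\alpha(C;Z)$ of order $\alpha>1$, with its approximation, be as defined in the context. Then the solutions to the optimization (minimization over $(\beta_0,\beta_1)\in\mathcal D$) of the adversary performance, of the maximal information leakage, and of the Sibson mutual information approximation are the same: $$\operatorname*{arg\,min}_{(\beta_0,\beta_1)\in\mathcal D}I_\alpha(C;Z)\approx\operatorname*{arg\,min}_{(\beta_0,\beta_1)\in\mathcal D}I_\infty(C;Z)=\operatorname*{arg\,min}_{(\beta_0,\beta_1)\in\mathcal D}\Pr(\hat C=C).$$
   Context: Let $\mu_0\le\mu_1$ be real numbers, $\sigma>0$, $\tilde p\in(0,1)$, $D\ge0$. $C\in\{0,1\}$ is a private label with $P(C=0)=\tilde p$, $P(C=1)=1-\tilde p$. Given $C=0$, $X\sim\mathcal N(\mu_0,\sigma^2)$; given $C=1$, $X\sim\mathcal N(\mu_1,\sigma^2)$. For parameters $\beta_0,\beta_1\ge 0$ the disclosed variable is $Z=X+(1-C)\beta_0-C\beta_1$, so that $Z\mid C=0\sim\mathcal N(\mu_0',\sigma^2)$ and $Z\mid C=1\sim\mathcal N(\mu_1',\sigma^2)$ with $\mu_0'=\mu_0+\beta_0$, $\mu_1'=\mu_1-\beta_1$; the parameters are required to satisfy $\mu_0'\le\mu_1'$ throughout. The distortion set is $$\mathcal D=\{(\beta_0,\beta_1):\ (1-\tilde p)\beta_0^2+\tilde p\,\beta_1^2\le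 D,\ \beta_0\ge 0,\ \beta_1\ge 0\}.$$ Write $p_{Z|C=c}$ for the conditional density of $Z$ given $C=c$. The MAP adversary knows the distribution of $Z$, observes $Z$, and outputs a guess $\hat C$ of $C$ of maximal posterior probability; $\Pr(\hat C=C)$ is its accuracy. The maximal information leakage is $I_\infty(C;Z)=\log\int_{\mathbb R}\max_{c\in\{0,1\}}p_{Z|C=c}(z)\,dz$. The Sibson mutual information of order $\alpha$ is $$I_\alpha(C;Z)=\frac{\alpha}{\alpha-1}\log\int_{\mathbb R}\big(\tilde p\,p_{Z|C=0}(z)^\alpha+(1-\tilde p)\,p_{Z|C=1}(z)^\alpha\big)^{1/\alpha}dz,$$ and its approximation is obtained by replacing the integrand with $\max\big(\tilde p^{1/\alpha}p_{Z|C=0}(z),(1-\tilde p)^{1/\alpha}p_{Z|C=1}(z)\big)$. The relation $\approx$ is not quantified; it refers to this approximation. *)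

theory Defs
  imports "HOL-Probability.Probability"
begin

text \<open>Throughout, a parameter pair $(\beta_0, \beta_1)$ is a value of type \<^typ>\<open>real \<times> real\<close>, and the
  label takes the values 0 and 1 of type \<^typ>\<open>nat\<close>.\<close>

definition disclosed :: "('a \<Rightarrow> nat) \<Rightarrow> ('a \<Rightarrow> real) \<Rightarrow> real \<times> real \<Rightarrow> 'a \<Rightarrow> real" where
  "disclosed C X \<beta> \<omega> = X \<omega> + (1 - real (C \<omega>)) * fst \<beta> - real (C \<omega>) * snd \<beta>"

definition distortion_set :: "real \<Rightarrow> real \<Rightarrow> (real \<times> real) set" where
  "distortion_set p D =
    {(\<beta>0, \<beta>1). (1 - p) * \<beta>0\<^sup>2 + p * \<beta>1\<^sup>2 \<le> D \<and> \<beta>0 \<ge> 0 \<and> \<beta>1 \<ge> 0}"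

text \<open>The standing requirement that the shifted means stay ordered is part of the feasible region
  of every optimization problem.\<close>

definition admissible_set :: "real \<Rightarrow> real \<Rightarrow> real \<Rightarrow> real \<Rightarrow> (real \<times> real) set" where
  "admissible_set \<mu>0 \<mu>1 p D =
    {(\<beta>0, \<beta>1) \<in> distortion_set p D. \<mu>0 + \<beta>0 \<le> \<mu>1 - \<beta>1}"

text \<open>The set of all minimizers; \<^const>\<open>arg_min\<close> would only select one of them.\<close>

definition arg_min_set :: "('b \<Rightarrow> real) \<Rightarrow> 'b set \<Rightarrow> 'b set" where
  "arg_min_set f S = {x. is_arg_min f (\<lambda>y. y \<in> S) x}"

definition prior :: "'a measure \<Rightarrow> ('a \<Rightarrow> nat) \<Rightarrow> nat \<Rightarrow> real" where
  "prior M C c = measure M {\<omega> \<in> space M. C \<omega> = c}"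

definition cond_measure :: "'a measure \<Rightarrow> ('a \<Rightarrow> nat) \<Rightarrow> nat \<Rightarrow> 'a measure" where
  "cond_measure M C c = uniform_measure M {\<omega> \<in> space M. C \<omega> = c}"

text \<open>The Radon-Nikodym derivative fixes one version of the conditional density; all notions below
  are unaffected by a change of version on a Lebesgue null set.\<close>

definition cond_density :: "'a measure \<Rightarrow> ('a \<Rightarrow> nat) \<Rightarrow> ('a \<Rightarrow> real) \<Rightarrow> nat \<Rightarrow> real \<Rightarrow> real" where
  "cond_density M C Z c z = enn2real (RN_deriv lborel (distr (cond_measure M C c) lborel Z) z)"

definition posterior :: "'a measure \<Rightarrow> ('a \<Rightarrow> nat) \<Rightarrow> ('a \<Rightarrow> real) \<Rightarrow> nat \<Rightarrow> real \<Rightarrow> real" where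
  "posterior M C Z c z =
    prior M C c * cond_density M C Z c z / (\<Sum>c'\<in>{0, 1}. prior M C c' * cond_density M C Z c' z)"

text \<open>A MAP rule is any measurable guess of maximal posterior probability, with no convention for
  breaking ties.\<close>

definition MAP_rule :: "'a measure \<Rightarrow> ('a \<Rightarrow> nat) \<Rightarrow> ('a \<Rightarrow> real) \<Rightarrow> (real \<Rightarrow> nat) \<Rightarrow> bool" where
  "MAP_rule M C Z g \<longleftrightarrow>
    g \<in> borel \<rightarrow>\<^sub>M count_space {0, 1} \<and>
    (AE z in distr M borel Z. \<forall>c\<in>{0, 1}. posterior M C Z c z \<le> posterior M C Z (g z) z)"

definition accuracy :: "'a measure \<Rightarrow> ('a \<Rightarrow> nat) \<Rightarrow> ('a \<Rightarrow> real) \<Rightarrow> (real \<Rightarrow> nat) \<Rightarrow> real" where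
  "accuracy M C Z g = measure M {\<omega> \<in> space M. g (Z \<omega>) = C \<omega>}"

definition max_leakage :: "'a measure \<Rightarrow> ('a \<Rightarrow> nat) \<Rightarrow> ('a \<Rightarrow> real) \<Rightarrow> real" where
  "max_leakage M C Z =
    ln (LINT z|lborel. max (cond_density M C Z 0 z) (cond_density M C Z 1 z))"

text \<open>The Sibson mutual information and its approximation are the same functional of two different
  integrands.\<close>

definition sibson_functional :: "real \<Rightarrow> (real \<Rightarrow> real) \<Rightarrow> real" where
  "sibson_functional \<alpha> h = \<alpha> / (\<alpha> - 1) * ln (LINT z|lborel. h z)"

definition sibson_mi :: "real \<Rightarrow> 'a measure \<Rightarrow> ('a \<Rightarrow> nat) \<Rightarrow> ('a \<Rightarrow> real) \<Rightarrow> real" where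
  "sibson_mi \<alpha> M C Z = sibson_functional \<alpha>
    (\<lambda>z. (prior M C 0 * cond_density M C Z 0 z powr \<alpha> +
          prior M C 1 * cond_density M C Z 1 z powr \<alpha>) powr (1 / \<alpha>))"

definition sibson_mi_approx :: "real \<Rightarrow> 'a measure \<Rightarrow> ('a \<Rightarrow> nat) \<Rightarrow> ('a \<Rightarrow> real) \<Rightarrow> real" where
  "sibson_mi_approx \<alpha> M C Z = sibson_functional \<alpha>
    (\<lambda>z. max (prior M C 0 powr (1 / \<alpha>) * cond_density M C Z 0 z)
             (prior M C 1 powr (1 / \<alpha>) * cond_density M C Z 1 z))"

end

theory Submission
  imports Defs
begin

text \<open>Each objective is a strictly increasing function of the integral of
  $\max(a\,p_{Z|C=0}, b\,p_{Z|C=1})$ for constant weights $a, b > 0$. For two normal densities of equal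
  variance this integral depends only on the distance $d = \mu_1' - \mu_0' \ge 0$ of the means, and it is
  strictly increasing in $d$ whatever the weights are. So all three problems have the same minimizers,
  namely those of $d$.\<close>

section \<open>Maximum of two weighted normal densities: growth of its integral with the distance of
  the means\<close>

text \<open>Equality of the integrals would force the nonnegative difference to vanish almost
  everywhere, but the interval where it is positive has positive Lebesgue measure.\<close>

lemma lborel_integral_strict_mono:
  fixes f g :: "real \<Rightarrow> real"
  assumes "integrable lborel f" "integrable lborel g" "\<And>x. f x \<le> g x"
    and "u < v" "\<And>x. u < x \<Longrightarrow> x < v \<Longrightarrow> f x < g x"
  shows "(LINT x|lborel. f x) < (LINT x|lborel. g x)"
proof -
  have int: "integrable lborel (\<lambda>x. g x - f x)" using assms by simp
  have "(LINT x|lborel. g x - f x) \<noteq> 0"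
  proof
    assume "(LINT x|lborel. g x - f x) = 0"
    then have "AE x in lborel. g x - f x = 0"
      using integral_nonneg_eq_0_iff_AE[OF int] assms(3) by simp
    then have "AE x in lborel. x \<notin> {u<..<v}"
      by eventually_elim (use assms(5) in force)
    then have "emeasure lborel {u<..<v} = 0"
      by (subst (asm) AE_iff_measurable[of "{u<..<v}"]) auto
    then show False using \<open>u < v\<close> by simp
  qed
  moreover have "0 \<le> (LINT x|lborel. g x - f x)" using assms(3) by simp
  ultimately show ?thesis using assms(1,2) by simp
qed

text \<open>Weights equal to the priors give the Bayes accuracy, unit weights the integral in the
  maximal leakage, and the priors raised to \<open>1 / \<alpha>\<close> the integral in the Sibson
  approximation. The first mean is normalized to 0.\<close>

definition max_mass :: "real \<Rightarrow> real \<Rightarrow> real \<Rightarrow> real \<Rightarrow> real" where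
  "max_mass a b \<sigma> d = (LINT z|lborel. max (a * normal_density 0 \<sigma> z) (b * normal_density d \<sigma> z))"

lemma integral_max_normal_density_shift:
  "(LINT z|lborel. max (a * normal_density m0 \<sigma> z) (b * normal_density m1 \<sigma> z))
    = max_mass a b \<sigma> (m1 - m0)"
  unfolding max_mass_def
  by (subst lborel_integral_real_affine[of 1 _ m0]) (simp_all add: normal_density_def algebra_simps)

lemma integrable_max_normal_density:
  "\<sigma> > 0 \<Longrightarrow> integrable lborel (\<lambda>z. max (a * normal_density m0 \<sigma> z) (b * normal_density m1 \<sigma> z))"
  by (intro integrable_max integrable_mult_right integrable_normal_density)

text \<open>With equal variances the logarithm of the ratio of the two weighted densities is affine
  in \<open>z\<close> with nonzero slope, so they cross exactly once. \<open>T\<close> is the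
  root.\<close>

lemma normal_density_crossing:
  fixes a b d \<sigma> z :: real
  assumes "0 < a" "0 < b" "0 < \<sigma>" "0 < d"
  defines "T \<equiv> (2 * \<sigma>\<^sup>2 * ln (a / b) + d\<^sup>2) / (2 * d)"
  shows "a * normal_density 0 \<sigma> z < b * normal_density d \<sigma> z \<longleftrightarrow> T < z"
    and "b * normal_density d \<sigma> z < a * normal_density 0 \<sigma> z \<longleftrightarrow> z < T"
proof -
  define k where "k = 1 / sqrt (2 * pi * \<sigma>\<^sup>2)"
  have k: "k > 0" using assms(3) by (simp add: k_def)
  have 0: "a * normal_density 0 \<sigma> z = k * exp (ln a - z\<^sup>2 / (2 * \<sigma>\<^sup>2))"
    using assms(1-4) by (simp add: normal_density_def k_def exp_add diff_conv_add_uminus del: add_uminus_conv_diff)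
  have 1: "b * normal_density d \<sigma> z = k * exp (ln b - (z - d)\<^sup>2 / (2 * \<sigma>\<^sup>2))"
    using assms(1-4) by (simp add: normal_density_def k_def exp_add diff_conv_add_uminus del: add_uminus_conv_diff)
  \<comment> \<open>The quadratic terms in \<open>z\<close> cancel here; this is where equal
    variances enter.\<close>
  have 2: "(ln a - z\<^sup>2 / (2 * \<sigma>\<^sup>2)) - (ln b - (z - d)\<^sup>2 / (2 * \<sigma>\<^sup>2)) = (T - z) * (d / \<sigma>\<^sup>2)"
    using assms(1-4) by (simp add: T_def ln_div divide_simps) (simp add: power2_eq_square algebra_simps)
  have 3: "d / \<sigma>\<^sup>2 > 0" using assms(3,4) by simp
  have "a * normal_density 0 \<sigma> z < b * normal_density d \<sigma> z \<longleftrightarrow> (T - z) * (d / \<sigma>\<^sup>2) < 0"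
    unfolding 0 1 2[symmetric] using k by simp
  also have "\<dots> \<longleftrightarrow> T < z" using 3 by (simp only: mult_less_0_iff) auto
  finally show "a * normal_density 0 \<sigma> z < b * normal_density d \<sigma> z \<longleftrightarrow> T < z" .
  have "b * normal_density d \<sigma> z < a * normal_density 0 \<sigma> z \<longleftrightarrow> 0 < (T - z) * (d / \<sigma>\<^sup>2)"
    unfolding 0 1 2[symmetric] using k by simp
  also have "\<dots> \<longleftrightarrow> z < T" using 3 by (simp only: zero_less_mult_iff) auto
  finally show "b * normal_density d \<sigma> z < a * normal_density 0 \<sigma> z \<longleftrightarrow> z < T" .
qed

text \<open>The weighted densities have total masses \<open>a\<close> and \<open>b\<close>. The
  maximum strictly exceeds the first to the right of the crossing point and the second to the left
  of it; any bounded interval on the relevant side witnesses strictness.\<close>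

lemma max_mass_gt_max:
  assumes "0 < a" "0 < b" "0 < \<sigma>" "0 < d"
  shows "max a b < max_mass a b \<sigma> d"
proof -
  define T where "T = (2 * \<sigma>\<^sup>2 * ln (a / b) + d\<^sup>2) / (2 * d)"
  note T = normal_density_crossing[OF assms, folded T_def]
  have "(LINT z|lborel. a * normal_density 0 \<sigma> z) < max_mass a b \<sigma> d"
    unfolding max_mass_def
    by (rule lborel_integral_strict_mono[where u = T and v = "T + 1"])
       (use assms T in \<open>auto intro!: integrable_max_normal_density simp: less_max_iff_disj\<close>)
  moreover have "(LINT z|lborel. b * normal_density d \<sigma> z) < max_mass a b \<sigma> d"
    unfolding max_mass_def
    by (rule lborel_integral_strict_mono[where u = "T - 1" and v = T])
       (use assms T in \<open>auto intro!: integrable_max_normal_density simp: less_max_iff_disj\<close>)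
  ultimately show ?thesis using assms by simp
qed

lemma max_mass_0: "0 < \<sigma> \<Longrightarrow> max_mass a b \<sigma> 0 = max a b"
proof -
  assume "0 < \<sigma>"
  have "max (a * normal_density 0 \<sigma> z) (b * normal_density 0 \<sigma> z) = max a b * normal_density 0 \<sigma> z" for z
    by (simp add: max_mult_distrib_right)
  then show ?thesis using \<open>0 < \<sigma>\<close> by (simp add: max_mass_def)
qed

text \<open>Translating the mean \<open>m\<close> to 0 turns the tail beyond \<open>T\<close> into
  the centred tail beyond \<open>T - m\<close>. A larger mean thus adds the mass of an interval,
  where the density is positive.\<close>

lemma integral_normal_density_tail_less:
  fixes T :: real
  assumes "0 < \<sigma>" "d < d'"
  shows "(LINT z|lborel. indicator {T<..} z * normal_density d \<sigma> z)
       < (LINT z|lborel. indicator {T<..} z * normal_density d' \<sigma> z)"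
proof -
  have shift: "(LINT z|lborel. indicator {T<..} z * normal_density m \<sigma> z)
      = (LINT z|lborel. indicator {T - m<..} z * normal_density 0 \<sigma> z)" for m
    by (subst lborel_integral_real_affine[of 1 _ m])
       (auto intro!: Bochner_Integration.integral_cong
             simp: normal_density_def indicator_def algebra_simps)
  have int: "integrable lborel (\<lambda>z. indicator {x<..} z * normal_density 0 \<sigma> z)" for x :: real
    using integrable_real_mult_indicator[of "{x<..}" lborel "normal_density 0 \<sigma>"] assms
    by (simp add: mult.commute)
  show ?thesis unfolding shift
    by (rule lborel_integral_strict_mono[where u = "T - d'" and v = "T - d"])
       (use assms int in \<open>auto simp: indicator_def normal_density_pos\<close>)
qed

lemma max_mass_strict_mono:
  assumes "0 < a" "0 < b" "0 < \<sigma>" "0 \<le> d" "d < d'"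
  shows "max_mass a b \<sigma> d < max_mass a b \<sigma> d'"
\<comment> \<open>For \<open>d = 0\<close> the weighted densities are proportional, so there is no
  crossing point; the maximum then has mass \<open>max a b\<close>, which any positive distance
  exceeds.\<close>
proof (cases "d = 0")
  case True
  then show ?thesis using max_mass_gt_max[of a b \<sigma> d'] assms by (simp add: max_mass_0)
next
  case False
  then have "d > 0" using assms by simp
  define T where "T = (2 * \<sigma>\<^sup>2 * ln (a / b) + d\<^sup>2) / (2 * d)"
  note T = normal_density_crossing[OF assms(1-3) \<open>d > 0\<close>, folded T_def]
  \<comment> \<open>The threshold \<open>T\<close> that is optimal for \<open>d\<close>, kept fixed while the right mean moves to
    \<open>d'\<close>, still bounds the maximum from below and already gains upper tail mass.\<close>
  define G where "G m z = a * (indicator {..T} z * normal_density 0 \<sigma> z)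
    + b * (indicator {T<..} z * normal_density m \<sigma> z)" for m z
  have i0: "integrable lborel (\<lambda>z. indicator {..T} z * normal_density 0 \<sigma> z)"
    using integrable_real_mult_indicator[of "{..T}" lborel "normal_density 0 \<sigma>"] assms
    by (simp add: mult.commute)
  have i1: "integrable lborel (\<lambda>z. indicator {T<..} z * normal_density m \<sigma> z)" for m
    using integrable_real_mult_indicator[of "{T<..}" lborel "normal_density m \<sigma>"] assms
    by (simp add: mult.commute)
  have G: "(LINT z|lborel. G m z) = a * (LINT z|lborel. indicator {..T} z * normal_density 0 \<sigma> z)
    + b * (LINT z|lborel. indicator {T<..} z * normal_density m \<sigma> z)" for m
    unfolding G_def using i0 i1 by simp
  \<comment> \<open>At \<open>z = T\<close> both weighted densities agree, so it does not matter
    which half contains that point.\<close>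
  have "max (a * normal_density 0 \<sigma> z) (b * normal_density d \<sigma> z) = G d z" for z
    using T[of z] by (auto simp: G_def indicator_def max_def)
  then have "max_mass a b \<sigma> d = (LINT z|lborel. G d z)"
    by (simp add: max_mass_def)
  also have "\<dots> < (LINT z|lborel. G d' z)"
    unfolding G using integral_normal_density_tail_less[of \<sigma> d d' T] assms by simp
  also have "\<dots> \<le> max_mass a b \<sigma> d'"
    unfolding max_mass_def
  proof (rule integral_mono)
    show "integrable lborel (G d')" unfolding G_def using i0 i1 by simp
  qed (use assms in \<open>auto intro: integrable_max_normal_density simp: G_def indicator_def\<close>)
  finally show ?thesis .
qed

lemma max_mass_pos:
  assumes "0 < a" "0 < b" "0 < \<sigma>" "0 \<le> d"
  shows "0 < max_mass a b \<sigma> d"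
  using max_mass_gt_max[of a b \<sigma> d] assms by (cases "d = 0") (auto simp: max_mass_0)

lemma max_mass_less_iff:
  assumes "0 < a" "0 < b" "0 < \<sigma>" "0 \<le> d" "0 \<le> d'"
  shows "max_mass a b \<sigma> d < max_mass a b \<sigma> d' \<longleftrightarrow> d < d'"
  using max_mass_strict_mono[OF assms(1-3), of d d'] max_mass_strict_mono[OF assms(1-3), of d' d] assms
  by (metis less_asym linorder_neqE_linordered_idom less_irrefl)

text \<open>A minimizer is a point of \<open>S\<close> with no strictly smaller value in
  \<open>S\<close>, so only the strict order that the objective induces on \<open>S\<close>
  matters.\<close>

lemma arg_min_set_eqI:
  assumes "\<And>x y. x \<in> S \<Longrightarrow> y \<in> S \<Longrightarrow> f x < f y \<longleftrightarrow> g x < g y"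
  shows "arg_min_set f S = arg_min_set g S"
  using assms by (auto simp: arg_min_set_def is_arg_min_def)

section \<open>Conditional law and density of the disclosed variable\<close>

lemma sets_cond_measure [simp, measurable_cong]: "sets (cond_measure M C c) = sets M"
  by (simp add: cond_measure_def)

lemma space_cond_measure [simp]: "space (cond_measure M C c) = space M"
  by (simp add: cond_measure_def)

lemma measurable_disclosed:
  assumes "C \<in> M \<rightarrow>\<^sub>M count_space {0, 1}" "X \<in> borel_measurable M"
  shows "disclosed C X \<beta> \<in> borel_measurable M"
proof -
  have [measurable]: "(\<lambda>\<omega>. real (C \<omega>)) \<in> borel_measurable M"
    by (rule measurable_compose[OF assms(1)]) simp
  note assms(2)[measurable]
  show ?thesis unfolding disclosed_def by measurable
qed

text \<open>Given \<open>C = c\<close> the label is almost surely constant, so the disclosed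
  variable is a translate of \<open>X\<close> by a fixed number.\<close>

lemma distributed_disclosed:
  assumes C: "C \<in> M \<rightarrow>\<^sub>M count_space {0, 1}" and "0 < \<sigma>"
    and X: "distributed (cond_measure M C c) lborel X (normal_density m \<sigma>)"
  shows "distributed (cond_measure M C c) lborel (disclosed C X \<beta>)
    (normal_density (m + (1 - real c) * fst \<beta> - real c * snd \<beta>) \<sigma>)"
proof -
  define s where "s = (1 - real c) * fst \<beta> - real c * snd \<beta>"
  have [measurable]: "X \<in> borel_measurable M" using distributed_measurable[OF X]
    by (simp cong: measurable_cong_sets)
  have mZ [measurable]: "disclosed C X \<beta> \<in> borel_measurable M"
    by (rule measurable_disclosed) (use C in auto)
  have A: "{\<omega> \<in> space M. C \<omega> = c} \<in> sets M"
    using measurable_sets[OF C, of "{c} \<inter> {0,1}"] measurable_space[OF C]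
    by (auto simp: vimage_def Int_def intro: back_subst[of "\<lambda>A. A \<in> sets M"])
  have shifted: "distributed (cond_measure M C c) lborel (\<lambda>\<omega>. s + 1 * X \<omega>)
      (normal_density (s + 1 * m) (\<bar>1\<bar> * \<sigma>))"
  proof (rule prob_space.normal_density_affine[OF _ X \<open>0 < \<sigma>\<close>])
    \<comment> \<open>The conditional measure inherits total mass 1 from the normal law of
      \<open>X\<close>.\<close>
    have "prob_space (distr (cond_measure M C c) lborel X)"
      using prob_space_normal_density[OF \<open>0 < \<sigma>\<close>] distributed_distr_eq_density[OF X] by simp
    then show "prob_space (cond_measure M C c)"
      by (rule prob_space_distrD[rotated]) (use distributed_measurable[OF X] in simp)
  qed simp
  have "AE \<omega> in cond_measure M C c. s + 1 * X \<omega> = disclosed C X \<beta> \<omega>"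
    unfolding cond_measure_def using A
    by (intro AE_uniform_measureI) (auto simp: s_def disclosed_def)
  then have "distr (cond_measure M C c) lborel (\<lambda>\<omega>. s + 1 * X \<omega>)
      = distr (cond_measure M C c) lborel (disclosed C X \<beta>)"
    by (intro distr_cong_AE) auto
  then show ?thesis using shifted
    by (simp add: distributed_def s_def algebra_simps)
qed

text \<open>Radon-Nikodym derivatives are unique up to null sets, so the version chosen in
  \<open>cond_density\<close> agrees almost everywhere with the explicit density.\<close>

lemma AE_cond_density_normal:
  assumes "distributed (cond_measure M C c) lborel Z (normal_density m \<sigma>)"
  shows "AE z in lborel. cond_density M C Z c z = normal_density m \<sigma> z"
proof -
  have "distr (cond_measure M C c) lborel Z = density lborel (normal_density m \<sigma>)"
    using assms by (rule distributed_distr_eq_density[symmetric, THEN sym])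
  then have "AE z in lborel. ennreal (normal_density m \<sigma> z)
      = RN_deriv lborel (distr (cond_measure M C c) lborel Z) z"
    by (intro sigma_finite_measure.RN_deriv_unique[OF sigma_finite_lborel]) auto
  then show ?thesis
    unfolding cond_density_def by eventually_elim (metis enn2real_ennreal normal_density_nonneg)
qed

lemma integral_max_cond_density:
  assumes "distributed (cond_measure M C 0) lborel Z (normal_density m0 \<sigma>)"
    and "distributed (cond_measure M C 1) lborel Z (normal_density m1 \<sigma>)"
  shows "(LINT z|lborel. max (a * cond_density M C Z 0 z) (b * cond_density M C Z 1 z))
    = max_mass a b \<sigma> (m1 - m0)"
  unfolding integral_max_normal_density_shift[symmetric]
proof (rule integral_cong_AE)
  show "AE z in lborel. max (a * cond_density M C Z 0 z) (b * cond_density M C Z 1 z)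
      = max (a * normal_density m0 \<sigma> z) (b * normal_density m1 \<sigma> z)"
    using assms[THEN AE_cond_density_normal] by eventually_elim simp
qed (auto simp: cond_density_def)

section \<open>Accuracy of a MAP rule\<close>

text \<open>The accuracy of a guess integrates prior times density of the guessed label. Maximal
  posterior makes this integrand the larger of the two candidates almost everywhere, and at a tie
  both choices contribute the same value.\<close>

lemma accuracy_MAP_rule:
  assumes "prob_space M" "0 < \<sigma>"
    and C: "C \<in> M \<rightarrow>\<^sub>M count_space {0, 1}" and Z: "Z \<in> borel_measurable M"
    and pos: "0 < prior M C 0" "0 < prior M C 1"
    and d0: "distributed (cond_measure M C 0) lborel Z (normal_density m0 \<sigma>)"
    and d1: "distributed (cond_measure M C 1) lborel Z (normal_density m1 \<sigma>)"
    and MAP: "MAP_rule M C Z g"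
  shows "accuracy M C Z g = max_mass (prior M C 0) (prior M C 1) \<sigma> (m1 - m0)"
proof -
  interpret prob_space M by fact
  define f where "f c = (if c = (0::nat) then normal_density m0 \<sigma> else normal_density m1 \<sigma>)" for c
  define A where "A c = {\<omega> \<in> space M. C \<omega> = c}" for c
  note Z[measurable] C[measurable]
  have g: "g \<in> borel \<rightarrow>\<^sub>M count_space {0, 1}" using MAP by (simp add: MAP_rule_def)
  note g[measurable]
  have g01: "g z \<in> {0,1}" for z using measurable_space[OF g, of z] by simp
  have C01: "C \<omega> \<in> {0,1}" if "\<omega> \<in> space M" for \<omega> using measurable_space[OF C that] by simp
  have A_sets: "A c \<in> sets M" for c
    using measurable_sets[OF C, of "{c} \<inter> {0,1}"] C01
    by (auto simp: vimage_def Int_def A_def intro: back_subst[of "\<lambda>A. A \<in> sets M"])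
  have gc_sets: "{z. g z = c} \<in> sets borel" for c
    using measurable_sets[OF g, of "{c} \<inter> {0,1}"] g01
    by (auto simp: vimage_def Int_def intro: back_subst[of "\<lambda>A. A \<in> sets borel"])
  have f_meas [measurable]: "f c \<in> borel_measurable borel" for c by (simp add: f_def)
  have f_pos: "f c z > 0" for c z using \<open>0 < \<sigma>\<close> by (simp add: f_def normal_density_pos)
  have distr: "distr (cond_measure M C c) lborel Z = density lborel (f c)" if "c \<in> {0,1}" for c
    using distributed_distr_eq_density[OF d0] distributed_distr_eq_density[OF d1] that
    by (auto simp: f_def)
  have prior_pos: "prior M C c > 0" if "c \<in> {0,1}" for c using that pos by auto
  \<comment> \<open>The joint probability of the label and of \<open>Z\<close> falling in
    \<open>B\<close> factors into prior times conditional probability.\<close>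
  have cond: "measure M (A c \<inter> (Z -` B \<inter> space M)) = prior M C c * (LINT z|lborel. indicator B z * f c z)"
    if "c \<in> {0,1}" "B \<in> sets borel" for c B
  proof -
    have ZB: "Z -` B \<inter> space M \<in> sets M" using Z that(2) by measurable
    have "measure (cond_measure M C c) (Z -` B \<inter> space M)
        = measure M (A c \<inter> (Z -` B \<inter> space M)) / measure M (A c)"
      unfolding cond_measure_def A_def[symmetric]
      using prior_pos[OF that(1)] A_sets ZB
      by (intro measure_uniform_measure) (auto simp: prior_def A_def emeasure_eq_measure)
    moreover have "measure (cond_measure M C c) (Z -` B \<inter> space M)
        = measure (distr (cond_measure M C c) lborel Z) B"
      using that by (subst measure_distr) auto
    moreover have "\<dots> = (LINT z|lborel. indicator B z * f c z)"
    proof -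
      have "measure (density lborel (f c)) B = (LINT z|density lborel (f c). indicator B z)"
        by simp
      also have "\<dots> = (LINT z|lborel. f c z * indicator B z)"
        using that f_pos[THEN less_imp_le] by (intro integral_real_density) auto
      finally show ?thesis unfolding distr[OF that(1)] by (simp add: mult.commute)
    qed
    ultimately show ?thesis using prior_pos[OF that(1)]
      by (simp add: prior_def A_def[symmetric] field_simps)
  qed
  \<comment> \<open>The MAP property holds almost everywhere under the law of \<open>Z\<close> and
    must be moved to Lebesgue measure. A null set for that law is null for the conditional law given
    label 0, and hence Lebesgue null because the normal density is positive everywhere.\<close>
  have "AE z in lborel. \<forall>c\<in>{0, 1}. posterior M C Z c z \<le> posterior M C Z (g z) z"
  proof -
    have "AE z in distr M borel Z. \<forall>c\<in>{0, 1}. posterior M C Z c z \<le> posterior M C Z (g z) z"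
      using MAP by (simp add: MAP_rule_def)
    then obtain N where N: "{z \<in> space (distr M borel Z). \<not> (\<forall>c\<in>{0, 1}. posterior M C Z c z \<le> posterior M C Z (g z) z)} \<subseteq> N"
        "emeasure (distr M borel Z) N = 0" "N \<in> sets (distr M borel Z)"
      by (rule AE_E)
    have "emeasure M (Z -` N \<inter> space M) = 0" using N(2,3) by (simp add: emeasure_distr)
    then have "emeasure (cond_measure M C 0) (Z -` N \<inter> space M) = 0"
      using A_sets[of 0] N(3) unfolding cond_measure_def A_def[symmetric]
      by (subst emeasure_uniform_measure) (auto intro: emeasure_eq_0 measurable_sets[OF Z])
    then have "emeasure (distr (cond_measure M C 0) lborel Z) N = 0"
      using N(3) by (subst emeasure_distr) auto
    then have "N \<in> null_sets (density lborel (f 0))"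
      using N(3) distr[of 0] by auto
    then have "AE z in density lborel (f 0). z \<notin> N" by (rule AE_not_in)
    then have "AE z in lborel. z \<notin> N"
      using f_pos by (simp add: AE_density)
    then show ?thesis by eventually_elim (use N(1) in auto)
  qed
  then have max_eq: "AE z in lborel. (\<Sum>c\<in>{0,1}. prior M C c * (indicator {z. g z = c} z * f c z))
      = max (prior M C 0 * normal_density m0 \<sigma> z) (prior M C 1 * normal_density m1 \<sigma> z)"
    using AE_cond_density_normal[OF d0] AE_cond_density_normal[OF d1]
  proof eventually_elim
    case (elim z)
    \<comment> \<open>Both posteriors share this positive denominator, so comparing them amounts to
      comparing numerators.\<close>
    have s: "0 < prior M C 0 * f 0 z + prior M C 1 * f 1 z"
      using pos f_pos by (intro add_pos_pos mult_pos_pos) auto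
    show ?case using elim s g01[of z]
      by (auto simp: posterior_def f_def divide_le_cancel max_def split: if_splits)
  qed
  \<comment> \<open>The event of a correct guess is split according to the value of the
    label.\<close>
  have "accuracy M C Z g = measure M (\<Union>c\<in>{0,1}. A c \<inter> (Z -` {z. g z = c} \<inter> space M))"
    unfolding accuracy_def A_def
  proof (intro arg_cong[where f = "measure M"] set_eqI)
    fix \<omega>
    show "\<omega> \<in> {\<omega> \<in> space M. g (Z \<omega>) = C \<omega>} \<longleftrightarrow>
        \<omega> \<in> (\<Union>c\<in>{0,1}. {\<omega> \<in> space M. C \<omega> = c} \<inter> (Z -` {z. g z = c} \<inter> space M))"
      using C01[of \<omega>] by auto
  qed
  also have "\<dots> = (\<Sum>c\<in>{0,1}. measure M (A c \<inter> (Z -` {z. g z = c} \<inter> space M)))"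
    using A_sets measurable_sets[OF Z gc_sets]
    by (intro finite_measure_finite_Union) (auto simp: disjoint_family_on_def A_def)
  also have "\<dots> = (\<Sum>c\<in>{0,1}. prior M C c * (LINT z|lborel. indicator {z. g z = c} z * f c z))"
    by (intro sum.cong refl cond gc_sets)
  also have "\<dots> = (LINT z|lborel. (\<Sum>c\<in>{0,1}. prior M C c * (indicator {z. g z = c} z * f c z)))"
  proof -
    have "integrable lborel (f c)" for c using \<open>0 < \<sigma>\<close> by (simp add: f_def)
    then have "integrable lborel (\<lambda>z. indicator {z. g z = c} z * f c z)" for c
      using integrable_real_mult_indicator[of "{z. g z = c}" lborel "f c"] gc_sets
      by (simp add: mult.commute)
    then show ?thesis by simp
  qed
  also have "\<dots> = max_mass (prior M C 0) (prior M C 1) \<sigma> (m1 - m0)"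
    unfolding integral_max_normal_density_shift[symmetric]
    using max_eq gc_sets by (intro integral_cong_AE) auto
  finally show ?thesis .
qed

section \<open>Equality of the three sets of minimizers\<close>

theorem mainTheorem5:
  fixes M :: "'a measure" and C :: "'a \<Rightarrow> nat" and X :: "'a \<Rightarrow> real"
    and \<mu>0 \<mu>1 \<sigma> p D \<alpha> :: real
    and guess :: "real \<times> real \<Rightarrow> real \<Rightarrow> nat"
  assumes "prob_space M"
    and "\<mu>0 \<le> \<mu>1" and "\<sigma> > 0" and "0 < p" and "p < 1" and "D \<ge> 0" and "\<alpha> > 1"
    and "C \<in> M \<rightarrow>\<^sub>M count_space {0, 1}"
    and "measure M {\<omega> \<in> space M. C \<omega> = 0} = p"
    and "measure M {\<omega> \<in> space M. C \<omega> = 1} = 1 - p"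
    and "distributed (cond_measure M C 0) lborel X (normal_density \<mu>0 \<sigma>)"
    and "distributed (cond_measure M C 1) lborel X (normal_density \<mu>1 \<sigma>)"
    and "\<And>\<beta>. \<beta> \<in> admissible_set \<mu>0 \<mu>1 p D \<Longrightarrow> MAP_rule M C (disclosed C X \<beta>) (guess \<beta>)"
  shows "arg_min_set (\<lambda>\<beta>. sibson_mi_approx \<alpha> M C (disclosed C X \<beta>)) (admissible_set \<mu>0 \<mu>1 p D) =
           arg_min_set (\<lambda>\<beta>. max_leakage M C (disclosed C X \<beta>)) (admissible_set \<mu>0 \<mu>1 p D) \<and>
         arg_min_set (\<lambda>\<beta>. max_leakage M C (disclosed C X \<beta>)) (admissible_set \<mu>0 \<mu>1 p D) =
           arg_min_set (\<lambda>\<beta>. accuracy M C (disclosed C X \<beta>) (guess \<beta>)) (admissible_set \<mu>0 \<mu>1 p D)"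
proof -
  \<comment> \<open>The signed distance of the shifted means; admissibility makes it nonnegative, as
    the monotonicity of \<open>max_mass\<close> requires.\<close>
  define \<delta> where "\<delta> \<beta> = (\<mu>1 - snd \<beta>) - (\<mu>0 + fst \<beta>)" for \<beta>
  let ?S = "admissible_set \<mu>0 \<mu>1 p D"
  have \<delta>_nonneg: "0 \<le> \<delta> \<beta>" if "\<beta> \<in> ?S" for \<beta>
    using that by (auto simp: admissible_set_def \<delta>_def)
  have prior: "prior M C 0 = p" "prior M C 1 = 1 - p" using assms by (simp_all add: prior_def)
  have X: "X \<in> borel_measurable M" using distributed_measurable[OF assms(11)]
    by (simp cong: measurable_cong_sets)
  have d0: "distributed (cond_measure M C 0) lborel (disclosed C X \<beta>) (normal_density (\<mu>0 + fst \<beta>) \<sigma>)" for \<beta>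
    using distributed_disclosed[OF assms(8) assms(3) assms(11), of \<beta>] by simp
  have d1: "distributed (cond_measure M C 1) lborel (disclosed C X \<beta>) (normal_density (\<mu>1 - snd \<beta>) \<sigma>)" for \<beta>
    using distributed_disclosed[OF assms(8) assms(3) assms(12), of \<beta>] by simp
  have sibson: "sibson_mi_approx \<alpha> M C (disclosed C X \<beta>)
      = \<alpha> / (\<alpha> - 1) * ln (max_mass (p powr (1 / \<alpha>)) ((1 - p) powr (1 / \<alpha>)) \<sigma> (\<delta> \<beta>))" for \<beta>
    unfolding sibson_mi_approx_def sibson_functional_def integral_max_cond_density[OF d0 d1] prior \<delta>_def ..
  have leak: "max_leakage M C (disclosed C X \<beta>) = ln (max_mass 1 1 \<sigma> (\<delta> \<beta>))" for \<beta>
    using integral_max_cond_density[OF d0 d1, where a = 1 and b = 1] by (simp add: max_leakage_def \<delta>_def)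
  \<comment> \<open>Restricted to admissible pairs, since \<open>guess\<close> is a MAP rule only
    there.\<close>
  have acc: "accuracy M C (disclosed C X \<beta>) (guess \<beta>) = max_mass p (1 - p) \<sigma> (\<delta> \<beta>)" if "\<beta> \<in> ?S" for \<beta>
    using accuracy_MAP_rule[OF assms(1,3,8) measurable_disclosed[OF assms(8) X] _ _ d0 d1 assms(13)[OF that],
        unfolded prior] assms(4,5) by (simp add: \<delta>_def)
  \<comment> \<open>As \<open>\<alpha> > 1\<close>, the factor in front of the logarithm preserves
    the order.\<close>
  have "\<alpha> / (\<alpha> - 1) > 0" using assms(7) by simp
  then have sibson_less: "sibson_mi_approx \<alpha> M C (disclosed C X x) < sibson_mi_approx \<alpha> M C (disclosed C X y)
      \<longleftrightarrow> \<delta> x < \<delta> y" if "x \<in> ?S" "y \<in> ?S" for x y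
    unfolding sibson using \<delta>_nonneg that assms(3-5)
    by (subst mult_less_cancel_left_pos) (simp_all add: max_mass_pos max_mass_less_iff)
  have leak_less: "max_leakage M C (disclosed C X x) < max_leakage M C (disclosed C X y)
      \<longleftrightarrow> \<delta> x < \<delta> y" if "x \<in> ?S" "y \<in> ?S" for x y
    unfolding leak using \<delta>_nonneg that assms(3)
    by (simp add: max_mass_pos max_mass_less_iff)
  have acc_less: "accuracy M C (disclosed C X x) (guess x) < accuracy M C (disclosed C X y) (guess y)
      \<longleftrightarrow> \<delta> x < \<delta> y" if "x \<in> ?S" "y \<in> ?S" for x y
    using \<delta>_nonneg that assms(3-5) by (simp add: acc max_mass_less_iff)
  show ?thesis
    using sibson_less leak_less acc_less by (intro conjI arg_min_set_eqI) simp_all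
qed

end
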